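(* Let $(G_m)_{m\in\mathbb{Z}}$ be a generalized Fibonacci sequence, let $a,b$ be integers, let $n\ge 0$ be an integer, and let $x$ be a complex number such that $\Delta := 1-L_b x+(-1)^b x^2\neq 0$. Then $$\sum_{k=0}^n x^k G_{a+bk} = -\frac{1}{\Delta}\left[ x^{n+1} P(1,n+1) - P(1,0) \right].$$
   Context: A generalized Fibonacci sequence is a sequence $(G_m)_{m\in\mathbb{Z}}$ of complex numbers with $G_{m+2}=G_{m+1}+G_m$ for all integers $m$ (with arbitrary seed $G_0,G_1$). $L_m$ is the Lucas number: $L_0=2$, $L_1=1$, $L_{m+2}=L_{m+1}+L_m$ for all integers $m$ (including negative indices). For given $a,b,x$ and $G$, and for integers $v,w\ge 0$, $P(v,w) = \sum_{k=0}^v \binom{v}{k} (-1)^{(b+1)k} x^k G_{a+bw-bk}$. Convention: $x^0=1$, also for $x=0$. *)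

theory Defs
  imports Complex_Main
begin

definition generalized_fibonacci :: "(int \<Rightarrow> complex) \<Rightarrow> bool" where
  "generalized_fibonacci G \<longleftrightarrow> (\<forall>m. G (m + 2) = G (m + 1) + G m)"

text \<open>
  The recurrence is run upwards for indices above 1 and backwards for negative indices;
  \<open>lucas_rec\<close> below shows that it then holds for all integers.
\<close>

function lucas :: "int \<Rightarrow> int" where
  "lucas m =
     (if m = 0 then 2
      else if m = 1 then 1
      else if m > 1 then lucas (m - 1) + lucas (m - 2)
      else lucas (m + 2) - lucas (m + 1))"
  by auto
termination
  by (relation "measure (\<lambda>m. nat \<bar>2 * m - 1\<bar>)") auto

declare lucas.simps [simp del]

lemma lucas_0: "lucas 0 = 2"
  by (simp add: lucas.simps)

lemma lucas_1: "lucas 1 = 1"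
  by (simp add: lucas.simps)

lemma lucas_rec: "lucas (m + 2) = lucas (m + 1) + lucas m"
proof (cases "m < 0")
  case True
  then show ?thesis by (subst (3) lucas.simps) simp
next
  case False
  then show ?thesis by (subst lucas.simps) (simp add: algebra_simps)
qed

text \<open>
  Exponents of \<open>-1\<close> may be negative, hence the integer power \<open>powi\<close>.
  The convention \<open>x ^ 0 = 1\<close>, also for \<open>x = 0\<close>, is that of the library.
\<close>

definition P ::
    "(int \<Rightarrow> complex) \<Rightarrow> int \<Rightarrow> int \<Rightarrow> complex \<Rightarrow> nat \<Rightarrow> nat \<Rightarrow> complex" where
  "P G a b x v w =
     (\<Sum>k=0..v. of_nat (v choose k) * (-1) powi ((b + 1) * int k) * x ^ k
                  * G (a + b * int w - b * int k))"

end

(*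
  The identity G (m + b) + (-1)^b G (m - b) = L_b G m says that multiplying by
  1 - L_b x + (-1)^b x^2 annihilates the inner terms of the sum, so the product telescopes.
*)
theory Submission
  imports Defs
begin

text \<open>Write s = (-1)^b, D = 1 - L_b x + s x^2 and m = a + b n. Substituting L_b G_m = G_{m+b}
  + s G_{m-b} (\<open>generalized_fibonacci_lucas_mult\<close>) into D x^n G_m leaves x^n (G_m - s x
  G_{m-b}) - x^(n+1) (G_{m+b} - s x G_m). By \<open>P_1\<close> this is x^n P(1,n) - x^(n+1)
  P(1,n+1), so D times the sum telescopes; it remains to divide by D.\<close>

lemma generalized_fibonacci_eq_0:
  assumes G: "generalized_fibonacci G" and "G 0 = 0" "G 1 = 0"
  shows "G m = 0"
proof -
  have rec: "G (m + 2) = G (m + 1) + G m" for m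
    using G by (simp add: generalized_fibonacci_def)
  \<comment> \<open>Two consecutive zeros propagate through the recurrence in both
    directions.\<close>
  have "G m = 0 \<and> G (m + 1) = 0"
  proof (induction m rule: int_induct[where k = 0])
    case base
    show ?case using assms by simp
  next
    case (step1 i)
    then show ?case using rec[of i] by (simp add: add.assoc)
  next
    case (step2 i)
    then show ?case using rec[of "i - 1"] by (simp add: add.commute)
  qed
  then show ?thesis ..
qed

text \<open>For fixed m, the difference of the two sides, as a function of the shift, is itself a
  generalized Fibonacci sequence, so it suffices that it vanishes at shifts 0 and 1.\<close>

lemma generalized_fibonacci_lucas_mult:
  assumes G: "generalized_fibonacci G"
  shows "of_int (lucas b) * G m = G (m + b) + (-1) powi b * G (m - b)"
proof -
  define D where "D c = G (m + c) + (-1) powi c * G (m - c) - of_int (lucas c) * G m" for c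
  have rec: "G (k + 2) = G (k + 1) + G k" for k
    using G by (simp add: generalized_fibonacci_def)
  have "D (c + 2) = D (c + 1) + D c" for c
  proof -
    have "G (m + (c + 2)) = G (m + (c + 1)) + G (m + c)"
      using rec[of "m + c"] by (simp add: algebra_simps)
    \<comment> \<open>Read in c, the recurrence runs backwards here: G_{m-c-2} = G_{m-c} -
      G_{m-c-1}. The alternating factor (-1)^c absorbs the minus sign.\<close>
    moreover have "G (m - c) = G (m - (c + 1)) + G (m - (c + 2))"
      using rec[of "m - (c + 2)"] by (simp add: algebra_simps)
    moreover have "(-1 :: complex) powi (c + 1) = - ((-1) powi c)"
      "(-1 :: complex) powi (c + 2) = (-1) powi c"
      by (simp_all add: power_int_add)
    ultimately show ?thesis
      by (simp add: D_def lucas_rec algebra_simps)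
  qed
  then have "generalized_fibonacci D"
    by (simp add: generalized_fibonacci_def)
  moreover have "D 0 = 0"
    by (simp add: D_def lucas_0)
  moreover have "D 1 = 0"
    using rec[of "m - 1"] by (simp add: D_def lucas_1 algebra_simps)
  ultimately have "D b = 0"
    by (rule generalized_fibonacci_eq_0)
  then show ?thesis by (simp add: D_def)
qed

lemma P_1:
  "P G a b x 1 w = G (a + b * int w) - (-1) powi b * x * G (a + b * int w - b)"
  by (simp add: P_def power_int_add)

text \<open>The telescoped sum in product form; the half-open range makes the base case an empty
  sum.\<close>

lemma sum_generalized_fibonacci:
  assumes G: "generalized_fibonacci G"
  shows "(1 - of_int (lucas b) * x + (-1) powi b * x ^ 2) * (\<Sum>k<n. x ^ k * G (a + b * int k))
    = P G a b x 1 0 - x ^ n * P G a b x 1 n"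
proof (induction n)
  case 0
  show ?case by simp
next
  case (Suc n)
  let ?m = "a + b * int n"
  let ?s = "(-1 :: complex) powi b"
  \<comment> \<open>The factor \<open>of_int (lucas b) * G ?m\<close> is isolated so that the Lucas
    identity can rewrite it.\<close>
  have "(1 - of_int (lucas b) * x + ?s * x ^ 2) * (x ^ n * G ?m)
      = x ^ n * (G ?m - x * (of_int (lucas b) * G ?m) + ?s * x ^ 2 * G ?m)"
    by (simp add: algebra_simps)
  also have "\<dots> = x ^ n * P G a b x 1 n - x ^ Suc n * P G a b x 1 (Suc n)"
    unfolding generalized_fibonacci_lucas_mult[OF G] P_1
    by (simp add: algebra_simps power2_eq_square)
  finally show ?case
    using Suc by (simp add: distrib_left)
qed

theorem mainTheorem1:
  fixes G :: "int \<Rightarrow> complex" and a b :: int and n :: nat and x :: complex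
  assumes "generalized_fibonacci G"
    and "1 - of_int (lucas b) * x + (-1) powi b * x ^ 2 \<noteq> 0"
  shows "(\<Sum>k=0..n. x ^ k * G (a + b * int k)) =
    - (1 / (1 - of_int (lucas b) * x + (-1) powi b * x ^ 2))
      * (x ^ (n + 1) * P G a b x 1 (n + 1) - P G a b x 1 0)"
proof -
  let ?d = "1 - of_int (lucas b) * x + (-1) powi b * x ^ 2"
  let ?S = "\<Sum>k=0..n. x ^ k * G (a + b * int k)"
  have "{0..n} = {..<n + 1}" by auto
  then have "?d * ?S = P G a b x 1 0 - x ^ (n + 1) * P G a b x 1 (n + 1)"
    by (simp only: sum_generalized_fibonacci[OF assms(1)])
  then have "?S * ?d = P G a b x 1 0 - x ^ (n + 1) * P G a b x 1 (n + 1)"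
    by (simp only: mult.commute)
  then have "?S = (P G a b x 1 0 - x ^ (n + 1) * P G a b x 1 (n + 1)) / ?d"
    by (simp only: nonzero_eq_divide_eq[OF assms(2)])
  then show ?thesis
    by (simp add: diff_divide_distrib)
qed

end
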